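(* Each of the following one-parameter families $\{C_\theta\}$ of bivariate Archimedean copulas is power-bounded, i.e. for every parameter value $\theta$ in the indicated range and every $\alpha>0$, $$\sup_{(u,v)\in[0,1]^2}\bigl| C_{\theta}(u,v)^{\alpha}\,\partial_{\theta}\log C_{\theta}(u,v)\bigr|<\infty :$$ (1) the Clayton family $C_\theta(u,v)=\bigl(u^{-\theta}+v^{-\theta}-1\bigr)^{-1/\theta}$, $\theta>0$; (2) the Gumbel family $C_\theta(u,v)=\exp\bigl\{-\bigl((-\log u)^{\theta}+(-\log v)^{\theta}\bigr)^{1/\theta}\bigr\}$, $\theta\ge 1$; (3) the Frank family $C_\theta(u,v)=-\frac1\theta\log\Bigl[1+\frac{(e^{-\theta u}-1)(e^{-\theta v}-1)}{e^{-\theta}-1}\Bigr]$, $\theta\in\mathbb{R}\setminus\{0\}$; (4) the Joe family $C_\theta(u,v)=1-\bigl[(1-u)^{\theta}+(1-v)^{\theta}-(1-u)^{\theta}(1-v)^{\theta}\bigr]^{1/\theta}$, $\theta\ge1$.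
   Context: The supremum is taken over points of $[0,1]^2$ where $C_\theta(u,v)>0$, so that $\log C_\theta(u,v)$ is defined; at the points where a formula is singular it is understood by continuous extension. At the endpoint $\theta=1$ (Gumbel, Joe) the derivative $\partial_\theta$ is one-sided (from the right). *)

theory Defs
  imports "HOL-Analysis.Analysis"
begin

text \<open>
  A one-parameter family is given by its parameter set \<open>\<Theta>\<close> and the map
  \<open>C \<theta> u v\<close>. The \<open>\<theta>\<close>-derivative is taken within \<open>\<Theta>\<close>:
  this is the ordinary derivative at interior points of \<open>\<Theta>\<close> and the right
  derivative at a left endpoint belonging to \<open>\<Theta>\<close>. As
  \<^const>\<open>vector_derivative\<close> is a total function, existence of the derivative is
  required explicitly. The supremum is formed in the extended reals, where it always exists.
\<close>

definition power_bounded :: "real set \<Rightarrow> (real \<Rightarrow> real \<Rightarrow> real \<Rightarrow> real) \<Rightarrow> bool" where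
  "power_bounded \<Theta> C \<longleftrightarrow>
     (\<forall>\<theta>\<in>\<Theta>. \<forall>\<alpha>>0.
        (\<forall>u\<in>{0..1}. \<forall>v\<in>{0..1}. C \<theta> u v > 0 \<longrightarrow>
           (\<lambda>t. ln (C t u v)) differentiable (at \<theta> within \<Theta>)) \<and>
        (SUP (u, v)\<in>{(u, v). u \<in> {0..1} \<and> v \<in> {0..1} \<and> C \<theta> u v > 0}.
           ereal \<bar>C \<theta> u v powr \<alpha> *
             vector_derivative (\<lambda>t. ln (C t u v)) (at \<theta> within \<Theta>)\<bar>) < \<infinity>)"

text \<open>
  On the edges \<open>u = 0\<close> and \<open>v = 0\<close> the Clayton and Gumbel formulas are singular
  and the continuous extension is \<open>0\<close>; the library conventions
  \<open>0 powr a = 0\<close> and \<open>ln 0 = 0\<close> would give other values there.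
  At \<open>u = 1\<close> or \<open>v = 1\<close> the convention \<open>0 powr a = 0\<close> is the correct
  value, since only positive exponents occur at base \<open>0\<close>.
\<close>

definition clayton :: "real \<Rightarrow> real \<Rightarrow> real \<Rightarrow> real" where
  "clayton \<theta> u v =
     (if u = 0 \<or> v = 0 then 0
      else (u powr (- \<theta>) + v powr (- \<theta>) - 1) powr (- 1 / \<theta>))"

definition gumbel :: "real \<Rightarrow> real \<Rightarrow> real \<Rightarrow> real" where
  "gumbel \<theta> u v =
     (if u = 0 \<or> v = 0 then 0
      else exp (- (((- ln u) powr \<theta> + (- ln v) powr \<theta>) powr (1 / \<theta>))))"

definition frank :: "real \<Rightarrow> real \<Rightarrow> real \<Rightarrow> real" where
  "frank \<theta> u v =
     - (1 / \<theta>) * ln (1 + (exp (- \<theta> * u) - 1) * (exp (- \<theta> * v) - 1) / (exp (- \<theta>) - 1))"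

definition joe :: "real \<Rightarrow> real \<Rightarrow> real \<Rightarrow> real" where
  "joe \<theta> u v =
     1 - ((1 - u) powr \<theta> + (1 - v) powr \<theta> - (1 - u) powr \<theta> * (1 - v) powr \<theta>) powr (1 / \<theta>)"

end

theory Submission imports Defs begin

text \<open>
  All four families satisfy \<open>C \<le> 1\<close> and \<open>\<bar>\<partial>\<^sub>\<theta> log C\<bar> \<le> K (1 - log C)\<close>, with \<open>K\<close> depending on
  \<open>\<theta>\<close> only; this suffices because \<open>c\<^sup>\<alpha> (- log c) \<le> 1 / \<alpha>\<close> on \<open>(0, 1]\<close>. For the Frank and the
  Joe family the logarithmic derivative is even bounded.
\<close>

section \<open>Elementary logarithmic inequalities and the reduction to a bound on the logarithmic
  derivative\<close>

lemma neg_mult_ln_le: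
  fixes x :: real
  assumes "0 < x"
  shows "x * (- ln x) \<le> 1 - x"
proof -
  have "- ln x \<le> 1 / x - 1"
    using ln_le_minus_one[of "1 / x"] assms by (simp add: ln_div)
  then have "x * (- ln x) \<le> x * (1 / x - 1)"
    using assms by (intro mult_left_mono) auto
  then show ?thesis
    using assms by (simp add: right_diff_distrib)
qed

text \<open>Applying \<open>neg_mult_ln_le\<close> to \<open>c powr \<alpha>\<close> produces
  \<open>\<alpha> * (- ln c)\<close>, so dividing by \<open>\<alpha>\<close> bounds the logarithmic
  part by \<open>1 / \<alpha>\<close>; the summand \<open>1\<close> comes from
  \<open>c powr \<alpha> \<le> 1\<close>.\<close>

lemma powr_mult_one_minus_ln_le:
  fixes c \<alpha> :: real
  assumes "0 < c" "c \<le> 1" "0 < \<alpha>"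
  shows "c powr \<alpha> * (1 - ln c) \<le> 1 + 1 / \<alpha>"
proof -
  have "c powr \<alpha> * (- ln (c powr \<alpha>)) \<le> 1 - c powr \<alpha>"
    using assms by (intro neg_mult_ln_le) auto
  also have "\<dots> \<le> 1"
    by simp
  finally have "c powr \<alpha> * (- ln c) \<le> 1 / \<alpha>"
    using assms by (simp add: ln_powr field_simps)
  moreover have "c powr \<alpha> \<le> 1"
    using assms by (simp add: powr_le1)
  ultimately show ?thesis
    by (simp add: algebra_simps)
qed

text \<open>The factor \<open>1 - ln (C \<theta> u v)\<close> accommodates both kinds of estimate
  that occur: bounds proportional to \<open>- ln C\<close> (Clayton, Gumbel) and constant bounds
  (Frank, Joe). The supremum is then at most \<open>\<bar>K\<bar> * (1 + 1 / \<alpha>)\<close>.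
  Hypothesis \<open>nontriv\<close> makes derivatives within \<open>\<Theta>\<close> unique, so that
  \<open>vector_derivative\<close> returns \<open>D\<close>.\<close>

lemma power_boundedI:
  assumes nontriv: "\<And>\<theta>. \<theta> \<in> \<Theta> \<Longrightarrow> at \<theta> within \<Theta> \<noteq> bot"
    and bound: "\<And>\<theta>. \<theta> \<in> \<Theta> \<Longrightarrow>
      \<exists>K. \<forall>u\<in>{0..1}. \<forall>v\<in>{0..1}. C \<theta> u v > 0 \<longrightarrow> C \<theta> u v \<le> 1 \<and>
        (\<exists>D. ((\<lambda>t. ln (C t u v)) has_real_derivative D) (at \<theta> within \<Theta>) \<and>
             \<bar>D\<bar> \<le> K * (1 - ln (C \<theta> u v)))"
  shows "power_bounded \<Theta> C"
  unfolding power_bounded_def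
proof (intro ballI allI impI conjI)
  fix \<theta> \<alpha> u v :: real
  assume "\<theta> \<in> \<Theta>" "u \<in> {0..1}" "v \<in> {0..1}" "C \<theta> u v > 0"
  then show "(\<lambda>t. ln (C t u v)) differentiable (at \<theta> within \<Theta>)"
    using bound[of \<theta>] real_differentiable_def by blast
next
  fix \<theta> \<alpha> :: real
  assume \<theta>: "\<theta> \<in> \<Theta>" and \<alpha>: "\<alpha> > 0"
  obtain K where K: "\<And>u v. u \<in> {0..1} \<Longrightarrow> v \<in> {0..1} \<Longrightarrow> C \<theta> u v > 0 \<Longrightarrow> C \<theta> u v \<le> 1 \<and>
        (\<exists>D. ((\<lambda>t. ln (C t u v)) has_real_derivative D) (at \<theta> within \<Theta>) \<and>
             \<bar>D\<bar> \<le> K * (1 - ln (C \<theta> u v)))"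
    using bound[OF \<theta>] by blast
  have le: "\<bar>C \<theta> u v powr \<alpha> * vector_derivative (\<lambda>t. ln (C t u v)) (at \<theta> within \<Theta>)\<bar>
      \<le> \<bar>K\<bar> * (1 + 1 / \<alpha>)"
    if uv: "u \<in> {0..1}" "v \<in> {0..1}" and pos: "C \<theta> u v > 0" for u v
  proof -
    obtain D where c1: "C \<theta> u v \<le> 1"
      and D: "((\<lambda>t. ln (C t u v)) has_real_derivative D) (at \<theta> within \<Theta>)"
      and DK: "\<bar>D\<bar> \<le> K * (1 - ln (C \<theta> u v))"
      using K[OF uv pos] by blast
    have "vector_derivative (\<lambda>t. ln (C t u v)) (at \<theta> within \<Theta>) = D"
      using vector_derivative_within[OF nontriv[OF \<theta>]] D
      by (simp add: has_real_derivative_iff_has_vector_derivative)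
    moreover have ln0: "ln (C \<theta> u v) \<le> 0"
      using pos c1 by simp
    \<comment> \<open>No sign is assumed for \<open>K\<close>; since \<open>1 - ln C\<close> is
      nonnegative, \<open>K\<close> may be replaced by \<open>\<bar>K\<bar>\<close>, which makes the
      later monotonicity steps valid.\<close>
    have "\<bar>D\<bar> \<le> \<bar>K\<bar> * (1 - ln (C \<theta> u v))"
      using DK ln0 by (meson abs_ge_self diff_ge_0_iff_ge mult_right_mono order_trans zero_le_one)
    then have "C \<theta> u v powr \<alpha> * \<bar>D\<bar> \<le> \<bar>K\<bar> * (C \<theta> u v powr \<alpha> * (1 - ln (C \<theta> u v)))"
      by (subst mult.left_commute) (intro mult_left_mono, auto)
    also have "\<dots> \<le> \<bar>K\<bar> * (1 + 1 / \<alpha>)"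
      using powr_mult_one_minus_ln_le[OF pos c1 \<alpha>] by (intro mult_left_mono) auto
    ultimately show ?thesis
      by (simp add: abs_mult)
  qed
  have "(SUP (u, v)\<in>{(u, v). u \<in> {0..1} \<and> v \<in> {0..1} \<and> C \<theta> u v > 0}.
           ereal \<bar>C \<theta> u v powr \<alpha> *
             vector_derivative (\<lambda>t. ln (C t u v)) (at \<theta> within \<Theta>)\<bar>)
       \<le> ereal (\<bar>K\<bar> * (1 + 1 / \<alpha>))"
    by (rule SUP_least) (use le in auto)
  also have "\<dots> < \<infinity>"
    by simp
  finally show "(SUP (u, v)\<in>{(u, v). u \<in> {0..1} \<and> v \<in> {0..1} \<and> C \<theta> u v > 0}.
           ereal \<bar>C \<theta> u v powr \<alpha> *
             vector_derivative (\<lambda>t. ln (C t u v)) (at \<theta> within \<Theta>)\<bar>) < \<infinity>" .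
qed

text \<open>Approaching \<open>x\<close> from the right stays inside \<open>{a..}\<close> even at
  the endpoint \<open>x = a\<close>. This serves the Gumbel and Joe families at
  \<open>\<theta> = 1\<close>.\<close>

lemma at_within_atLeast_neq_bot:
  fixes a x :: real
  assumes "a \<le> x"
  shows "at x within {a..} \<noteq> bot"
proof -
  have "at_right x \<le> at x within {a..}"
    using assms by (intro at_le) auto
  then show ?thesis
    by (metis bot.extremum_uniqueI trivial_limit_at_right_real)
qed

section \<open>The Clayton family\<close>

text \<open>With \<open>a = - ln u\<close> and \<open>b = - ln v\<close> one has
  \<open>ln C = - ln (S t) / t\<close>, where \<open>S t = exp (t * a) + exp (t * b) - 1\<close>.
  Since \<open>S\<close> dominates both exponentials,
  \<open>S' / S \<le> a + b \<le> 2 * ln S / \<theta>\<close>. Hence both terms of the derivative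
  are controlled by \<open>ln S\<close>, that is, by \<open>- ln C\<close>.\<close>

lemma clayton_log_derivative:
  fixes \<theta> u v :: real
  assumes \<theta>: "0 < \<theta>" and u: "0 < u" "u \<le> 1" and v: "0 < v" "v \<le> 1"
  shows "clayton \<theta> u v \<le> 1"
    and "\<exists>D. ((\<lambda>t. ln (clayton t u v)) has_real_derivative D) (at \<theta> within {0<..}) \<and>
             \<bar>D\<bar> \<le> (3 / \<theta>) * (1 - ln (clayton \<theta> u v))"
proof -
  define a b where "a = - ln u" and "b = - ln v"
  have ab: "0 \<le> a" "0 \<le> b"
    using u v by (auto simp: a_def b_def)
  define S where "S t = exp (t * a) + exp (t * b) - 1" for t
  have S_ge: "exp (t * a) \<le> S t" "exp (t * b) \<le> S t" "1 \<le> S t" if "0 < t" for t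
    using ab that one_le_exp_iff[of "t * a"] one_le_exp_iff[of "t * b"]
    by (auto simp: S_def intro: add_increasing simp del: one_le_exp_iff)
  have C: "clayton t u v = S t powr (- 1 / t)" if "0 < t" for t
    using u v by (simp add: clayton_def S_def a_def b_def powr_def)
  have lnC: "ln (clayton t u v) = - (1 / t) * ln (S t)" if "0 < t" for t
    using S_ge(3)[OF that] by (simp add: C[OF that] ln_powr)
  show "clayton \<theta> u v \<le> 1"
    using C[OF \<theta>] S_ge(3)[OF \<theta>] \<theta> by (simp add: powr_def)
  define S' where "S' = a * exp (\<theta> * a) + b * exp (\<theta> * b)"
  define D where "D = 1 / \<theta>\<^sup>2 * ln (S \<theta>) - 1 / \<theta> * (S' / S \<theta>)"
  have Spos: "0 < S \<theta>"
    using S_ge(3)[OF \<theta>] by simp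
  have "(S has_real_derivative S') (at \<theta> within {0<..})"
    unfolding S_def S'_def by (auto intro!: derivative_eq_intros simp: mult.commute)
  then have "((\<lambda>t. - (1 / t) * ln (S t)) has_real_derivative D) (at \<theta> within {0<..})"
    using Spos \<theta> unfolding D_def
    by (auto intro!: derivative_eq_intros simp: power2_eq_square field_simps)
  \<comment> \<open>The closed form of \<open>ln (clayton t u v)\<close> holds on the whole
    parameter set, so the radius \<open>d = 1\<close> is an arbitrary choice.\<close>
  then have "((\<lambda>t. ln (clayton t u v)) has_real_derivative D) (at \<theta> within {0<..})"
    by (rule has_field_derivative_transform_within[where d = 1]) (use \<theta> lnC in auto)
  moreover have "\<bar>D\<bar> \<le> (3 / \<theta>) * (1 - ln (clayton \<theta> u v))"
  proof -
    have L: "\<theta> * a \<le> ln (S \<theta>)" "\<theta> * b \<le> ln (S \<theta>)" "0 \<le> ln (S \<theta>)"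
      using S_ge[OF \<theta>] Spos by (auto simp: ln_ge_iff)
    have "S' \<le> a * S \<theta> + b * S \<theta>"
      unfolding S'_def using S_ge[OF \<theta>] ab by (intro add_mono mult_left_mono) auto
    then have q: "S' / S \<theta> \<le> a + b"
      using Spos by (simp add: divide_le_eq distrib_right)
    have "\<theta> * (S' / S \<theta>) \<le> \<theta> * (a + b)"
      using q \<theta> by (intro mult_left_mono) auto
    also have "\<dots> \<le> 2 * ln (S \<theta>)"
      using L by (simp add: distrib_left)
    finally have q2: "\<theta> * (S' / S \<theta>) \<le> 2 * ln (S \<theta>)" .
    have q0: "0 \<le> \<theta> * (S' / S \<theta>)"
      using ab \<theta> Spos by (simp add: S'_def)
    have "D = (ln (S \<theta>) - \<theta> * (S' / S \<theta>)) / \<theta>\<^sup>2"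
      using \<theta> by (simp add: D_def power2_eq_square field_simps)
    \<comment> \<open>The subtracted term lies between \<open>0\<close> and
      \<open>2 * ln (S \<theta>)\<close>, whence the crude constant
      \<open>3 = 1 + 2\<close>.\<close>
    moreover have abs_le: "\<bar>ln (S \<theta>) - \<theta> * (S' / S \<theta>)\<bar> \<le> 3 * ln (S \<theta>)"
      using q2 q0 L(3) by linarith
    ultimately have "\<bar>D\<bar> \<le> 3 * ln (S \<theta>) / \<theta>\<^sup>2"
      using abs_le by (simp add: divide_right_mono)
    also have "\<dots> = (3 / \<theta>) * (- ln (clayton \<theta> u v))"
      using \<theta> by (simp add: lnC power2_eq_square)
    also have "\<dots> \<le> (3 / \<theta>) * (1 - ln (clayton \<theta> u v))"
      using \<theta> by (intro mult_left_mono) auto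
    finally show ?thesis .
  qed
  ultimately show "\<exists>D. ((\<lambda>t. ln (clayton t u v)) has_real_derivative D) (at \<theta> within {0<..}) \<and>
             \<bar>D\<bar> \<le> (3 / \<theta>) * (1 - ln (clayton \<theta> u v))"
    by blast
qed

lemma power_bounded_clayton: "power_bounded {0<..} clayton"
proof (rule power_boundedI)
  fix \<theta> :: real
  assume \<theta>: "\<theta> \<in> {0<..}"
  then show "at \<theta> within {0<..} \<noteq> bot"
    using at_within_open[of \<theta> "{0<..}"] by simp
  have "clayton \<theta> u v \<le> 1 \<and>
      (\<exists>D. ((\<lambda>t. ln (clayton t u v)) has_real_derivative D) (at \<theta> within {0<..}) \<and>
        \<bar>D\<bar> \<le> (3 / \<theta>) * (1 - ln (clayton \<theta> u v)))"
    if "u \<in> {0..1}" "v \<in> {0..1}" "0 < clayton \<theta> u v" for u v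
  proof -
    \<comment> \<open>On the edges \<open>u = 0\<close> and \<open>v = 0\<close> the value is
      \<open>0\<close> by definition, so positivity of the copula excludes them.\<close>
    have "0 < u" "0 < v"
      using that by (auto simp: clayton_def less_le)
    with that \<theta> clayton_log_derivative[of \<theta> u v] show ?thesis
      by auto
  qed
  then show "\<exists>K. \<forall>u\<in>{0..1}. \<forall>v\<in>{0..1}. clayton \<theta> u v > 0 \<longrightarrow> clayton \<theta> u v \<le> 1 \<and>
      (\<exists>D. ((\<lambda>t. ln (clayton t u v)) has_real_derivative D) (at \<theta> within {0<..}) \<and>
        \<bar>D\<bar> \<le> K * (1 - ln (clayton \<theta> u v)))"
    by blast
qed

section \<open>The Gumbel family\<close>

text \<open>The exponent is \<open>- ln C\<close>, so its derivative has to be bounded by a multiple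
  of itself. Its logarithmic derivative depends on \<open>a\<close> and \<open>b\<close> only
  through two weights \<open>p\<close> and \<open>q\<close> with \<open>p + q = 1\<close>, which is
  why the constant is uniform.\<close>

lemma gumbel_exponent_derivative:
  fixes a b \<theta> :: real
  assumes \<theta>: "1 \<le> \<theta>" and ab: "0 \<le> a" "0 \<le> b"
  shows "\<exists>D. ((\<lambda>t. (a powr t + b powr t) powr (1 / t)) has_real_derivative D) (at \<theta> within {1..}) \<and>
             \<bar>D\<bar> \<le> 2 * (a powr \<theta> + b powr \<theta>) powr (1 / \<theta>)"
proof (cases "a = 0 \<or> b = 0")
  case True
  \<comment> \<open>This is the case \<open>u = 1\<close> or \<open>v = 1\<close>: as
    \<open>0 powr t = 0\<close>, the exponent does not depend on \<open>t\<close>. It is split off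
    because the general derivative formula involves \<open>ln a\<close> and
    \<open>ln b\<close>.\<close>
  then have "(a powr t + b powr t) powr (1 / t) = a + b" if "1 \<le> t" for t
    using ab that by (auto simp: powr_powr)
  moreover have "((\<lambda>t. a + b) has_real_derivative 0) (at \<theta> within {1..})"
    by simp
  ultimately have "((\<lambda>t. (a powr t + b powr t) powr (1 / t)) has_real_derivative 0) (at \<theta> within {1..})"
    using \<theta> by (elim has_field_derivative_transform_within[where d = 1]) auto
  then show ?thesis
    by (intro exI[of _ 0]) auto
next
  case False
  with ab have pos: "0 < a" "0 < b"
    by auto
  define S where "S t = a powr t + b powr t" for t
  have Spos: "0 < S t" for t
    using pos by (simp add: S_def add_pos_pos)
  define p q where "p = a powr \<theta> / S \<theta>" and "q = b powr \<theta> / S \<theta>"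
  have pq: "0 < p" "0 < q" "p + q = 1"
    using pos Spos[of \<theta>] by (auto simp: p_def q_def S_def add_divide_distrib[symmetric])
  define T where "T = S \<theta> powr (1 / \<theta>)"
  define E where "E = (p * ln p + q * ln q) / \<theta>\<^sup>2"
  \<comment> \<open>The logarithmic derivative of the exponent is minus an entropy, up to the factor \<open>1 / \<theta>\<^sup>2\<close>.\<close>
  have "ln p = \<theta> * ln a - ln (S \<theta>)" "ln q = \<theta> * ln b - ln (S \<theta>)"
    using pos Spos[of \<theta>] by (auto simp: p_def q_def ln_div ln_powr)
  then have "p * ln p + q * ln q = \<theta> * (p * ln a + q * ln b) - (p + q) * ln (S \<theta>)"
    by (simp only:) (simp add: algebra_simps)
  then have E: "E = (p * ln a + q * ln b) / \<theta> - ln (S \<theta>) / \<theta>\<^sup>2"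
    using pq \<theta> by (simp add: E_def diff_divide_distrib power2_eq_square)
  have "(S has_real_derivative (a powr \<theta> * ln a + b powr \<theta> * ln b)) (at \<theta>)"
    unfolding S_def using pos by (auto intro!: derivative_eq_intros simp: powr_def)
  then have "((\<lambda>t. ln (S t) / t) has_real_derivative E) (at \<theta>)"
    using Spos[of \<theta>] \<theta> unfolding E
    by (auto intro!: derivative_eq_intros simp: p_def q_def power2_eq_square field_simps)
  from DERIV_fun_exp[OF this] have "((\<lambda>t. exp (ln (S t) / t)) has_real_derivative T * E) (at \<theta>)"
    using Spos[of \<theta>] by (simp add: T_def powr_def)
  then have "((\<lambda>t. S t powr (1 / t)) has_real_derivative T * E) (at \<theta>)"
    using Spos by (simp add: powr_def less_imp_neq[symmetric])
  moreover have "\<bar>T * E\<bar> \<le> 2 * T"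
  proof -
    \<comment> \<open>Each entropy term is at most \<open>1\<close>, which gives the constant
      \<open>2\<close>; the factor \<open>1 / \<theta>\<^sup>2\<close> is at most \<open>1\<close>
      because \<open>\<theta> \<ge> 1\<close>.\<close>
    have "- (p * ln p) \<le> 1" "- (q * ln q) \<le> 1" "p * ln p \<le> 0" "q * ln q \<le> 0"
      using neg_mult_ln_le[of p] neg_mult_ln_le[of q] pq by (auto simp: mult_le_0_iff)
    then have "\<bar>p * ln p + q * ln q\<bar> \<le> 2"
      by linarith
    moreover have "1 \<le> \<theta>\<^sup>2"
      using \<theta> by simp
    ultimately have "\<bar>E\<bar> \<le> 2 / 1"
      unfolding E_def abs_divide by (intro frac_le) auto
    moreover have "0 < T"
      using Spos[of \<theta>] by (simp add: T_def)
    ultimately show ?thesis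
      by (simp add: abs_mult mult.commute)
  qed
  ultimately show ?thesis
    unfolding S_def T_def by (intro exI[of _ "T * E"]) (auto simp: S_def T_def intro: has_field_derivative_at_within)
qed

lemma power_bounded_gumbel: "power_bounded {1..} gumbel"
proof (rule power_boundedI)
  fix \<theta> :: real
  assume \<theta>: "\<theta> \<in> {1..}"
  then show "at \<theta> within {1..} \<noteq> bot"
    by (simp add: at_within_atLeast_neq_bot)
  have "gumbel \<theta> u v \<le> 1 \<and>
      (\<exists>D. ((\<lambda>t. ln (gumbel t u v)) has_real_derivative D) (at \<theta> within {1..}) \<and>
        \<bar>D\<bar> \<le> 2 * (1 - ln (gumbel \<theta> u v)))"
    if "u \<in> {0..1}" "v \<in> {0..1}" "0 < gumbel \<theta> u v" for u v
  proof -
    have uv: "0 < u" "0 < v"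
      using that by (auto simp: gumbel_def less_le)
    define a b where "a = - ln u" and "b = - ln v"
    have ab: "0 \<le> a" "0 \<le> b"
      using uv that by (auto simp: a_def b_def)
    have C: "gumbel t u v = exp (- ((a powr t + b powr t) powr (1 / t)))" for t
      using uv by (simp add: gumbel_def a_def b_def)
    obtain D where "((\<lambda>t. (a powr t + b powr t) powr (1 / t)) has_real_derivative D) (at \<theta> within {1..})"
      and "\<bar>D\<bar> \<le> 2 * (a powr \<theta> + b powr \<theta>) powr (1 / \<theta>)"
      using gumbel_exponent_derivative[of \<theta> a b] \<theta> ab by auto
    then have "((\<lambda>t. ln (gumbel t u v)) has_real_derivative - D) (at \<theta> within {1..})"
      "\<bar>- D\<bar> \<le> 2 * (1 - ln (gumbel \<theta> u v))"
      unfolding C by (auto intro: DERIV_minus)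
    moreover have "gumbel \<theta> u v \<le> 1"
      by (simp add: C)
    ultimately show ?thesis
      by blast
  qed
  then show "\<exists>K. \<forall>u\<in>{0..1}. \<forall>v\<in>{0..1}. gumbel \<theta> u v > 0 \<longrightarrow> gumbel \<theta> u v \<le> 1 \<and>
      (\<exists>D. ((\<lambda>t. ln (gumbel t u v)) has_real_derivative D) (at \<theta> within {1..}) \<and>
        \<bar>D\<bar> \<le> K * (1 - ln (gumbel \<theta> u v)))"
    by blast
qed

section \<open>The Frank family\<close>

text \<open>For \<open>y \<ge> 0\<close> multiply \<open>1 - y \<le> exp (- y)\<close> by
  \<open>exp y\<close>; for \<open>y < 0\<close> use \<open>1 + y \<le> exp y\<close>.\<close>

lemma abs_exp_minus_one_le:
  fixes y :: real
  shows "\<bar>exp y - 1\<bar> \<le> \<bar>y\<bar> * exp \<bar>y\<bar>"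
proof (cases "0 \<le> y")
  case True
  have "exp y * (1 - y) \<le> exp y * exp (- y)"
    using exp_ge_add_one_self[of "- y"] by (intro mult_left_mono) auto
  with True show ?thesis
    by (simp add: exp_minus algebra_simps)
next
  case False
  then have "exp y < 1"
    by simp
  then have "\<bar>exp y - 1\<bar> \<le> \<bar>y\<bar> * 1"
    using exp_ge_add_one_self[of y] by linarith
  also have "\<dots> \<le> \<bar>y\<bar> * exp \<bar>y\<bar>"
    by (intro mult_left_mono) auto
  finally show ?thesis .
qed

text \<open>The same two inequalities, with the roles of the signs exchanged, give the linear lower
  bound needed for denominators.\<close>

lemma abs_exp_minus_one_ge:
  fixes y :: real
  shows "\<bar>y\<bar> * exp (- \<bar>y\<bar>) \<le> \<bar>exp y - 1\<bar>"
proof (cases "0 \<le> y")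
  case True
  then have "\<bar>y\<bar> * exp (- \<bar>y\<bar>) \<le> \<bar>y\<bar> * 1"
    by (intro mult_left_mono) auto
  also have "\<dots> \<le> \<bar>exp y - 1\<bar>"
    using True exp_ge_add_one_self[of y] by linarith
  finally show ?thesis .
next
  case False
  have "exp y * (1 - y) \<le> exp y * exp (- y)"
    using exp_ge_add_one_self[of "- y"] by (intro mult_left_mono) auto
  with False show ?thesis
    by (simp add: exp_minus algebra_simps)
qed

text \<open>Numerator and denominator both vanish to first order at \<open>u = 0\<close>, so a
  factor \<open>u\<close> cancels and the bound does not depend on \<open>u\<close>. Up to sign the
  quotient is the \<open>\<theta>\<close>-derivative of
  \<open>ln \<bar>exp (- \<theta> * u) - 1\<bar>\<close>.\<close>

lemma frank_log_derivative_term_bound: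
  fixes \<theta> u :: real
  assumes \<theta>: "\<theta> \<noteq> 0" and u: "0 < u" "u \<le> 1"
  shows "\<bar>u * exp (- \<theta> * u) / (exp (- \<theta> * u) - 1)\<bar> \<le> exp \<bar>\<theta>\<bar> / \<bar>\<theta>\<bar>"
proof -
  have "u * exp (- \<theta> * u) / (exp (- \<theta> * u) - 1) = u / (1 - exp (\<theta> * u))"
    using \<theta> u by (simp add: exp_minus divide_simps)
  \<comment> \<open>Since \<open>\<bar>\<theta> * u\<bar> \<le> \<bar>\<theta>\<bar>\<close>, the
    exponential factor can be made independent of \<open>u\<close>, leaving a lower bound linear in
    \<open>u\<close>.\<close>
  moreover have "\<bar>\<theta>\<bar> * u * exp (- \<bar>\<theta>\<bar>) \<le> \<bar>\<theta> * u\<bar> * exp (- \<bar>\<theta> * u\<bar>)"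
    using u \<theta> by (auto simp: abs_mult intro!: mult_left_mono mult_left_le)
  then have "\<bar>\<theta>\<bar> * u * exp (- \<bar>\<theta>\<bar>) \<le> \<bar>exp (\<theta> * u) - 1\<bar>"
    using abs_exp_minus_one_ge[of "\<theta> * u"] by linarith
  then have "u / \<bar>exp (\<theta> * u) - 1\<bar> \<le> u / (\<bar>\<theta>\<bar> * u * exp (- \<bar>\<theta>\<bar>))"
    using u \<theta> by (intro divide_left_mono) auto
  moreover have "u / (\<bar>\<theta>\<bar> * u * exp (- \<bar>\<theta>\<bar>)) = exp \<bar>\<theta>\<bar> / \<bar>\<theta>\<bar>"
    using u by (simp add: exp_minus field_simps)
  ultimately show ?thesis
    using u by (simp add: abs_divide abs_minus_commute)
qed

text \<open>\<open>A\<close> is a convex combination of \<open>1\<close> and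
  \<open>exp (- \<theta> * u)\<close>, with weight \<open>r\<close> on the latter, and both numbers
  lie between \<open>exp (- \<bar>\<theta>\<bar>)\<close> and
  \<open>exp \<bar>\<theta>\<bar>\<close>.\<close>

lemma frank_argument_bounds:
  fixes \<theta> u v :: real
  assumes \<theta>: "\<theta> \<noteq> 0" and u: "0 \<le> u" "u \<le> 1" and v: "0 \<le> v" "v \<le> 1"
  defines "A \<equiv> 1 + (exp (- \<theta> * u) - 1) * (exp (- \<theta> * v) - 1) / (exp (- \<theta>) - 1)"
  shows "0 < A" and "\<bar>ln A\<bar> \<le> \<bar>\<theta>\<bar>"
proof -
  define r where "r = (exp (- \<theta> * v) - 1) / (exp (- \<theta>) - 1)"
  have r: "0 \<le> r" "r \<le> 1"
  proof -
    consider "0 < \<theta>" | "\<theta> < 0"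
      using \<theta> by linarith
    then have "0 \<le> r \<and> r \<le> 1"
    proof cases
      case 1
      with v have "- \<theta> \<le> - \<theta> * v" "- \<theta> * v \<le> 0"
        by (auto simp: mult_left_le)
      then have "exp (- \<theta>) \<le> exp (- \<theta> * v)" "exp (- \<theta> * v) \<le> 1" "exp (- \<theta>) < 1"
        using 1 by (auto simp del: mult_minus_left)
      then show ?thesis
        by (auto simp: r_def divide_simps)
    next
      case 2
      with v have "- \<theta> * v \<le> - \<theta>" "0 \<le> - \<theta> * v"
        using mult_left_le[of v "- \<theta>"] by (auto simp: mult_nonpos_nonneg)
      then have "exp (- \<theta> * v) \<le> exp (- \<theta>)" "1 \<le> exp (- \<theta> * v)" "1 < exp (- \<theta>)"
        using 2 by (auto simp del: mult_minus_left)
      then show ?thesis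
        by (auto simp: r_def divide_simps)
    qed
    then show "0 \<le> r" "r \<le> 1" by auto
  qed
  have A: "A = (1 - r) * 1 + r * exp (- \<theta> * u)"
    by (simp add: A_def r_def algebra_simps diff_divide_distrib add_divide_distrib)
  have "\<bar>- \<theta> * u\<bar> \<le> \<bar>\<theta>\<bar>"
    using u by (simp add: abs_mult mult_left_le)
  then have e: "exp (- \<bar>\<theta>\<bar>) \<le> exp (- \<theta> * u)" "exp (- \<theta> * u) \<le> exp \<bar>\<theta>\<bar>"
    by (auto simp del: mult_minus_left)
  have "(1 - r) * exp (- \<bar>\<theta>\<bar>) + r * exp (- \<bar>\<theta>\<bar>) \<le> A"
    unfolding A using r e by (intro add_mono mult_left_mono) auto
  then have lo: "exp (- \<bar>\<theta>\<bar>) \<le> A"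
    by (simp add: algebra_simps)
  have "A \<le> (1 - r) * exp \<bar>\<theta>\<bar> + r * exp \<bar>\<theta>\<bar>"
    unfolding A using r e by (intro add_mono mult_left_mono) auto
  then have hi: "A \<le> exp \<bar>\<theta>\<bar>"
    by (simp add: algebra_simps)
  show "0 < A"
    using lo exp_gt_zero less_le_trans by blast
  then have "- \<bar>\<theta>\<bar> \<le> ln A" "ln A \<le> \<bar>\<theta>\<bar>"
    using lo hi ln_le_cancel_iff[of A "exp \<bar>\<theta>\<bar>"] by (auto simp: ln_ge_iff)
  then show "\<bar>ln A\<bar> \<le> \<bar>\<theta>\<bar>"
    by linarith
qed

text \<open>Put \<open>A = 1 + w\<close> and \<open>y = ln A\<close>, so that
  \<open>C = - y / \<theta>\<close>. The logarithmic derivative is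
  \<open>- 1 / \<theta> + R * (w / (exp y * y))\<close>. Here \<open>R\<close> consists of three
  bounded terms, and \<open>w = exp y - 1\<close> vanishes to first order with \<open>y\<close>, so
  nothing blows up where \<open>C\<close> tends to \<open>0\<close>.\<close>

lemma frank_log_derivative:
  fixes \<theta> u v :: real
  assumes \<theta>: "\<theta> \<noteq> 0" and u: "0 < u" "u \<le> 1" and v: "0 < v" "v \<le> 1" and pos: "0 < frank \<theta> u v"
  shows "frank \<theta> u v \<le> 1"
    and "\<exists>D. ((\<lambda>t. ln (frank t u v)) has_real_derivative D) (at \<theta>) \<and>
             \<bar>D\<bar> \<le> 1 / \<bar>\<theta>\<bar> + 3 * (exp \<bar>\<theta>\<bar> / \<bar>\<theta>\<bar>) * exp (2 * \<bar>\<theta>\<bar>)"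
proof -
  define E where "E s t = exp (- t * s) - 1" for s t :: real
  define A where "A t = 1 + E u t * E v t / E 1 t" for t
  have C: "frank t u v = - (1 / t) * ln (A t)" for t
    by (simp add: frank_def A_def E_def)
  have Apos: "0 < A \<theta>" and lnA: "\<bar>ln (A \<theta>)\<bar> \<le> \<bar>\<theta>\<bar>"
    using frank_argument_bounds[of \<theta> u v] \<theta> u v by (auto simp: A_def E_def)
  show "frank \<theta> u v \<le> 1"
  proof -
    have "frank \<theta> u v \<le> \<bar>frank \<theta> u v\<bar>"
      by simp
    also have "\<dots> = \<bar>ln (A \<theta>)\<bar> / \<bar>\<theta>\<bar>"
      by (simp add: C abs_mult)
    also have "\<dots> \<le> 1"
      using lnA \<theta> by simp
    finally show ?thesis .
  qed
  have E0: "E s \<theta> \<noteq> 0" if "0 < s" for s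
    using that \<theta> by (simp add: E_def)
  \<comment> \<open>\<open>e s\<close> is the logarithmic derivative of \<open>E s\<close> at
    \<open>\<theta>\<close>; accordingly \<open>R\<close> below is that of the product
    \<open>w\<close>.\<close>
  define e where "e s = - (s * exp (- \<theta> * s) / E s \<theta>)" for s
  have DE: "(E s has_real_derivative e s * E s \<theta>) (at \<theta>)" if "0 < s" for s
    using E0[OF that] unfolding e_def E_def by (auto intro!: derivative_eq_intros)
  define w where "w = E u \<theta> * E v \<theta> / E 1 \<theta>"
  define R where "R = e u + e v - e 1"
  have DA: "(A has_real_derivative R * w) (at \<theta>)"
    unfolding A_def R_def w_def using E0[of u] E0[of v] E0[of 1] u v
    by (auto intro!: derivative_eq_intros DE simp: field_simps)
  define y where "y = ln (A \<theta>)"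
  \<comment> \<open>As \<open>y = - \<theta> * C\<close>, positivity of the copula permits division
    by \<open>y\<close>.\<close>
  have y0: "y \<noteq> 0"
    using pos by (auto simp: C y_def)
  have Aexp: "A \<theta> = exp y"
    using Apos by (simp add: y_def)
  have w: "w = exp y - 1"
    using Aexp by (simp add: A_def w_def)
  define D where "D = - 1 / \<theta> + R * (w / (exp y * y))"
  have "((\<lambda>t. - (1 / t) * ln (A t)) has_real_derivative (y / \<theta>\<^sup>2 - R * w / (\<theta> * exp y))) (at \<theta>)"
    using DA Apos \<theta> unfolding y_def
    by (auto intro!: derivative_eq_intros simp: power2_eq_square field_simps)
  then have "((\<lambda>t. frank t u v) has_real_derivative (y / \<theta>\<^sup>2 - R * w / (\<theta> * exp y))) (at \<theta>)"
    unfolding C .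
  then have "((\<lambda>t. ln (frank t u v)) has_real_derivative
      (1 / frank \<theta> u v) * (y / \<theta>\<^sup>2 - R * w / (\<theta> * exp y))) (at \<theta>)"
    using pos by (auto intro!: derivative_eq_intros)
  moreover have "(1 / frank \<theta> u v) * (y / \<theta>\<^sup>2 - R * w / (\<theta> * exp y)) = D"
    using \<theta> y0 by (simp add: C y_def[symmetric] D_def power2_eq_square field_simps)
  ultimately have der: "((\<lambda>t. ln (frank t u v)) has_real_derivative D) (at \<theta>)"
    by simp
  have "\<bar>e s\<bar> \<le> exp \<bar>\<theta>\<bar> / \<bar>\<theta>\<bar>" if "0 < s" "s \<le> 1" for s
    using frank_log_derivative_term_bound[OF \<theta> that] by (simp add: e_def E_def)
  from this[of u] this[of v] this[of 1] have R: "\<bar>R\<bar> \<le> 3 * (exp \<bar>\<theta>\<bar> / \<bar>\<theta>\<bar>)"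
    using u v unfolding R_def by linarith
  \<comment> \<open>The upper bound for \<open>\<bar>exp y - 1\<bar>\<close> carries a factor
    \<open>\<bar>y\<bar>\<close> that cancels the denominator; what remains is bounded through
    \<open>\<bar>y\<bar> - y \<le> 2 * \<bar>y\<bar> \<le> 2 * \<bar>\<theta>\<bar>\<close>.\<close>
  have "\<bar>w / (exp y * y)\<bar> = \<bar>w\<bar> / (exp y * \<bar>y\<bar>)"
    by (simp add: abs_mult)
  also have "\<dots> \<le> \<bar>y\<bar> * exp \<bar>y\<bar> / (exp y * \<bar>y\<bar>)"
    unfolding w by (intro divide_right_mono abs_exp_minus_one_le) auto
  also have "\<dots> = exp (\<bar>y\<bar> - y)"
    using y0 by (simp add: exp_diff)
  also have "\<dots> \<le> exp (2 * \<bar>\<theta>\<bar>)"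
    using lnA by (simp add: y_def)
  finally have W: "\<bar>w / (exp y * y)\<bar> \<le> exp (2 * \<bar>\<theta>\<bar>)" .
  have "\<bar>D\<bar> \<le> \<bar>- 1 / \<theta>\<bar> + \<bar>R\<bar> * \<bar>w / (exp y * y)\<bar>"
    unfolding D_def abs_mult[symmetric] by (rule abs_triangle_ineq)
  also have "\<dots> \<le> 1 / \<bar>\<theta>\<bar> + 3 * (exp \<bar>\<theta>\<bar> / \<bar>\<theta>\<bar>) * exp (2 * \<bar>\<theta>\<bar>)"
    using R W by (intro add_mono mult_mono) auto
  finally show "\<exists>D. ((\<lambda>t. ln (frank t u v)) has_real_derivative D) (at \<theta>) \<and>
             \<bar>D\<bar> \<le> 1 / \<bar>\<theta>\<bar> + 3 * (exp \<bar>\<theta>\<bar> / \<bar>\<theta>\<bar>) * exp (2 * \<bar>\<theta>\<bar>)"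
    using der by blast
qed

lemma power_bounded_frank: "power_bounded (UNIV - {0}) frank"
proof (rule power_boundedI)
  fix \<theta> :: real
  assume "\<theta> \<in> UNIV - {0}"
  then have \<theta>: "\<theta> \<noteq> 0"
    by simp
  have at: "at \<theta> within (UNIV - {0}) = at \<theta>"
    using \<theta> by (intro at_within_open) auto
  then show "at \<theta> within (UNIV - {0}) \<noteq> bot"
    by simp
  define K where "K = 1 / \<bar>\<theta>\<bar> + 3 * (exp \<bar>\<theta>\<bar> / \<bar>\<theta>\<bar>) * exp (2 * \<bar>\<theta>\<bar>)"
  have "frank \<theta> u v \<le> 1 \<and>
      (\<exists>D. ((\<lambda>t. ln (frank t u v)) has_real_derivative D) (at \<theta> within (UNIV - {0})) \<and>
        \<bar>D\<bar> \<le> K * (1 - ln (frank \<theta> u v)))"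
    if uv01: "u \<in> {0..1}" "v \<in> {0..1}" and pos: "0 < frank \<theta> u v" for u v
  proof -
    have uv: "0 < u" "0 < v"
      using uv01 pos by (auto simp: frank_def less_le)
    have C1: "frank \<theta> u v \<le> 1"
      using frank_log_derivative(1)[of \<theta> u v] \<theta> uv uv01 pos by auto
    obtain D where "((\<lambda>t. ln (frank t u v)) has_real_derivative D) (at \<theta>)" and D: "\<bar>D\<bar> \<le> K"
      using frank_log_derivative(2)[of \<theta> u v] \<theta> uv uv01 pos unfolding K_def by auto
    \<comment> \<open>The constant bound is weakened to the shape required by
      \<open>power_boundedI\<close>, using \<open>K \<ge> 0\<close> and
      \<open>ln C \<le> 0\<close>.\<close>
    moreover have "K * 1 \<le> K * (1 - ln (frank \<theta> u v))"
      using pos C1 by (intro mult_left_mono) (auto simp: K_def)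
    ultimately show ?thesis
      using C1 D by (auto simp: at)
  qed
  then show "\<exists>K. \<forall>u\<in>{0..1}. \<forall>v\<in>{0..1}. frank \<theta> u v > 0 \<longrightarrow> frank \<theta> u v \<le> 1 \<and>
      (\<exists>D. ((\<lambda>t. ln (frank t u v)) has_real_derivative D) (at \<theta> within (UNIV - {0})) \<and>
        \<bar>D\<bar> \<le> K * (1 - ln (frank \<theta> u v)))"
    by blast
qed

section \<open>The Joe family\<close>

text \<open>Concavity of \<open>x powr p\<close> in \<open>x\<close>, obtained from Young's
  inequality for \<open>x\<close> and \<open>1\<close> with weights \<open>p\<close> and
  \<open>1 - p\<close>.\<close>

lemma one_minus_powr_ge:
  fixes x p :: real
  assumes x: "0 < x" "x \<le> 1" and p: "0 < p" "p \<le> 1"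
  shows "p * (1 - x) \<le> 1 - x powr p"
proof -
  have "x powr p \<le> p * x + (1 - p) * 1"
    using Youngs_inequality_0[of p "1 - p" x 1] x p by simp
  then show ?thesis
    by (simp add: algebra_simps)
qed

text \<open>The left side is a contribution to the derivative of \<open>T\<close>, where
  \<open>C = 1 - T\<close>, and must vanish as fast as \<open>1 - T\<close>. The chain is
  \<open>T / S * x \<le> a\<close>, then \<open>a * (- ln a) \<le> 1 - a \<le> 1 - x\<close>; the
  factor \<open>1 - y\<close> completes this to \<open>(1 - x) * (1 - y) = 1 - S\<close>, and
  concavity converts \<open>1 - S\<close> into \<open>\<theta> * (1 - T)\<close>.\<close>

lemma joe_term_bound:
  fixes a b \<theta> :: real
  assumes \<theta>: "1 \<le> \<theta>" and a: "0 < a" "a < 1" and b: "0 < b" "b < 1"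
  defines "x \<equiv> a powr \<theta>" and "y \<equiv> b powr \<theta>"
  defines "S \<equiv> x + y - x * y"
  defines "T \<equiv> S powr (1 / \<theta>)"
  shows "T * (x * (- ln a) * (1 - y) / S) \<le> \<theta> * (1 - T)"
proof -
  have xy: "0 < x" "x < 1" "0 < y" "y < 1"
    using a b \<theta> by (auto simp: x_def y_def powr01_less_one)
  have Sx: "x \<le> S" "0 < S" "S \<le> 1"
  proof -
    have "S = x + y * (1 - x)" "1 - S = (1 - x) * (1 - y)"
      by (auto simp: S_def algebra_simps)
    moreover have "0 \<le> y * (1 - x)" "0 \<le> (1 - x) * (1 - y)"
      using xy by auto
    ultimately show "x \<le> S" "0 < S" "S \<le> 1"
      using xy by linarith+
  qed
  have "T / S = S powr (1 / \<theta> - 1)"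
    using Sx by (simp add: T_def powr_diff)
  \<comment> \<open>The exponent is nonpositive because \<open>\<theta> \<ge> 1\<close>, so
    \<open>x \<le> S\<close> reverses.\<close>
  also have "\<dots> \<le> x powr (1 / \<theta> - 1)"
    using \<theta> xy Sx by (intro powr_mono2') auto
  also have "\<dots> = a / x"
    using a \<theta> xy by (simp add: powr_diff x_def powr_powr)
  finally have "T / S * x \<le> a"
    using xy by (simp add: field_simps)
  then have "T / S * x * ((- ln a) * (1 - y)) \<le> a * ((- ln a) * (1 - y))"
    using a xy by (intro mult_right_mono mult_nonneg_nonneg) auto
  also have "\<dots> = a * (- ln a) * (1 - y)"
    by simp
  also have "\<dots> \<le> (1 - a) * (1 - y)"
    using neg_mult_ln_le[OF a(1)] xy by (intro mult_right_mono) auto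
  also have "\<dots> \<le> (1 - x) * (1 - y)"
  proof -
    have "x \<le> a powr 1"
      unfolding x_def using a \<theta> by (intro powr_mono') auto
    then show ?thesis
      using a xy by (intro mult_right_mono) auto
  qed
  also have "\<dots> = 1 - S"
    by (simp add: S_def algebra_simps)
  also have "\<dots> \<le> \<theta> * (1 - T)"
    using one_minus_powr_ge[of S "1 / \<theta>"] Sx \<theta> by (simp add: T_def field_simps)
  finally show ?thesis
    by (simp add: mult.assoc mult.left_commute)
qed

text \<open>For \<open>a = 1 - u\<close>, \<open>b = 1 - v\<close> and \<open>C = 1 - T\<close>, the
  derivative of \<open>T\<close> is \<open>(L - P - Q) / \<theta>\<close>, with \<open>L\<close>
  from the outer exponent \<open>1 / t\<close> and \<open>P\<close>, \<open>Q\<close> from the inner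
  powers. Each of the three lies between \<open>0\<close> and \<open>\<theta> * (1 - T)\<close>,
  hence the constant \<open>3\<close>.\<close>

lemma joe_log_derivative:
  fixes a b \<theta> :: real
  assumes \<theta>: "1 \<le> \<theta>" and a: "0 \<le> a" "a < 1" and b: "0 \<le> b" "b < 1"
  shows "\<exists>D. ((\<lambda>t. ln (1 - (a powr t + b powr t - a powr t * b powr t) powr (1 / t)))
               has_real_derivative D) (at \<theta> within {1..}) \<and> \<bar>D\<bar> \<le> 3"
proof (cases "a = 0 \<or> b = 0")
  case True
  \<comment> \<open>This is the case \<open>u = 1\<close> or \<open>v = 1\<close>, where the copula
    does not depend on the parameter.\<close>
  then have "ln (1 - (a powr t + b powr t - a powr t * b powr t) powr (1 / t)) = ln (1 - (a + b))"
    if "1 \<le> t" for t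
    using a b that by (auto simp: powr_powr)
  moreover have "((\<lambda>t. ln (1 - (a + b))) has_real_derivative 0) (at \<theta> within {1..})"
    by simp
  ultimately have "((\<lambda>t. ln (1 - (a powr t + b powr t - a powr t * b powr t) powr (1 / t)))
               has_real_derivative 0) (at \<theta> within {1..})"
    using \<theta> by (elim has_field_derivative_transform_within[where d = 1]) auto
  then show ?thesis
    by (intro exI[of _ 0]) auto
next
  case False
  with a b have pos: "0 < a" "0 < b"
    by auto
  define S where "S t = a powr t + b powr t - a powr t * b powr t" for t
  have S: "0 < S t" "S t < 1" if "0 < t" for t
  proof -
    have *: "0 < a powr t" "a powr t < 1" "0 < b powr t" "b powr t < 1"
      using pos a b that by (auto simp: powr01_less_one)
    have "S t = a powr t + b powr t * (1 - a powr t)" "1 - S t = (1 - a powr t) * (1 - b powr t)"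
      by (auto simp: S_def algebra_simps)
    moreover have "0 < b powr t * (1 - a powr t)" "0 < (1 - a powr t) * (1 - b powr t)"
      using * by auto
    ultimately show "0 < S t" "S t < 1"
      using * by linarith+
  qed
  define T where "T = S \<theta> powr (1 / \<theta>)"
  have S\<theta>: "0 < S \<theta>" "S \<theta> < 1"
    using S \<theta> by auto
  have T: "0 < T" "T < 1"
    using S\<theta> \<theta> by (auto simp: T_def powr01_less_one)
  define x y where "x = a powr \<theta>" and "y = b powr \<theta>"
  have xy: "0 < x" "x < 1" "0 < y" "y < 1"
    using pos a b \<theta> by (auto simp: x_def y_def powr01_less_one)
  define P where "P = T * (x * (- ln a) * (1 - y) / S \<theta>)"
  define Q where "Q = T * (y * (- ln b) * (1 - x) / S \<theta>)"
  define L where "L = T * (- ln T)"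
  have lnT: "ln T = ln (S \<theta>) / \<theta>"
    using S\<theta> by (simp add: T_def ln_powr)
  have DS: "(S has_real_derivative (x * ln a * (1 - y) + y * ln b * (1 - x))) (at \<theta>)"
    unfolding S_def x_def y_def using pos
    by (auto intro!: derivative_eq_intros simp: powr_def algebra_simps)
  have "((\<lambda>t. ln (S t) / t) has_real_derivative
      (x * ln a * (1 - y) + y * ln b * (1 - x)) / S \<theta> / \<theta> - ln (S \<theta>) / \<theta>\<^sup>2) (at \<theta>)"
    using DS S\<theta> \<theta>
    by (auto intro!: derivative_eq_intros simp: power2_eq_square field_simps)
  from DERIV_fun_exp[OF this] have "((\<lambda>t. exp (ln (S t) / t)) has_real_derivative
      T * ((x * ln a * (1 - y) + y * ln b * (1 - x)) / S \<theta> / \<theta> - ln (S \<theta>) / \<theta>\<^sup>2)) (at \<theta>)"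
    using S\<theta> by (simp add: T_def powr_def)
  moreover have "T * ((x * ln a * (1 - y) + y * ln b * (1 - x)) / S \<theta> / \<theta> - ln (S \<theta>) / \<theta>\<^sup>2)
      = (L - P - Q) / \<theta>"
    using S\<theta> \<theta> by (simp add: L_def P_def Q_def lnT power2_eq_square field_simps)
  moreover define h where "h = (\<lambda>t. exp (ln (S t) / t))"
  ultimately have "(h has_real_derivative (L - P - Q) / \<theta>) (at \<theta> within {1..})"
    by (simp add: has_field_derivative_at_within)
  moreover have "h \<theta> = T"
    using S\<theta> by (simp add: h_def T_def powr_def)
  ultimately have "((\<lambda>t. ln (1 - h t)) has_real_derivative
      - ((L - P - Q) / \<theta>) / (1 - T)) (at \<theta> within {1..})"
    using T by (auto intro!: derivative_eq_intros)
  \<comment> \<open>Rewriting the power as \<open>exp (ln (S t) / t)\<close> needs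
    \<open>S t > 0\<close>, which is available for \<open>t > 0\<close>; this is why the transfer
    takes place within \<open>{1..}\<close>.\<close>
  then have der: "((\<lambda>t. ln (1 - S t powr (1 / t))) has_real_derivative
      - ((L - P - Q) / \<theta>) / (1 - T)) (at \<theta> within {1..})"
    by (rule has_field_derivative_transform_within[where d = 1])
      (use \<theta> S(1) in \<open>force simp: h_def powr_def\<close>)+
  have L: "0 \<le> L" "L \<le> 1 - T"
    using T neg_mult_ln_le[of T] by (auto simp: L_def mult_le_0_iff)
  have P: "0 \<le> P" "P \<le> \<theta> * (1 - T)"
    using joe_term_bound[of \<theta> a b] \<theta> a b pos xy S\<theta> T
    by (auto simp: P_def T_def S_def x_def y_def mult_le_0_iff divide_le_0_iff mult_nonneg_nonpos)
  have Q: "0 \<le> Q" "Q \<le> \<theta> * (1 - T)"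
    using joe_term_bound[of \<theta> b a] \<theta> a b pos xy S\<theta> T
    by (auto simp: Q_def T_def S_def x_def y_def mult_le_0_iff divide_le_0_iff add.commute mult.commute mult_nonneg_nonpos)
  have "1 * (1 - T) \<le> \<theta> * (1 - T)"
    using \<theta> T by (intro mult_right_mono) auto
  then have "L \<le> \<theta> * (1 - T)"
    using L(2) by simp
  then have "\<bar>L - P - Q\<bar> \<le> 3 * (\<theta> * (1 - T))"
    using L(1) P Q by linarith
  then have "\<bar>- ((L - P - Q) / \<theta>) / (1 - T)\<bar> \<le> 3"
    using \<theta> T by (simp add: abs_divide divide_le_eq mult_ac)
  with der show ?thesis
    unfolding S_def by blast
qed

lemma power_bounded_joe: "power_bounded {1..} joe"
proof (rule power_boundedI)
  fix \<theta> :: real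
  assume \<theta>: "\<theta> \<in> {1..}"
  then show "at \<theta> within {1..} \<noteq> bot"
    by (simp add: at_within_atLeast_neq_bot)
  have "joe \<theta> u v \<le> 1 \<and>
      (\<exists>D. ((\<lambda>t. ln (joe t u v)) has_real_derivative D) (at \<theta> within {1..}) \<and>
        \<bar>D\<bar> \<le> 3 * (1 - ln (joe \<theta> u v)))"
    if uv01: "u \<in> {0..1}" "v \<in> {0..1}" and pos: "0 < joe \<theta> u v" for u v
  proof -
    \<comment> \<open>If \<open>u = 0\<close> or \<open>v = 0\<close>, the bracket in
      \<open>joe\<close> equals \<open>1\<close> and the copula vanishes, so positivity excludes
      these edges.\<close>
    have "0 < u" "0 < v"
      using uv01 pos by (auto simp: joe_def less_le)
    then obtain D where der: "((\<lambda>t. ln (joe t u v)) has_real_derivative D) (at \<theta> within {1..})"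
      and D: "\<bar>D\<bar> \<le> 3"
      using joe_log_derivative[of \<theta> "1 - u" "1 - v"] \<theta> uv01 by (auto simp: joe_def)
    have le: "joe \<theta> u v \<le> 1"
      by (simp add: joe_def)
    then have "ln (joe \<theta> u v) \<le> 0"
      using pos by simp
    with D have "\<bar>D\<bar> \<le> 3 * (1 - ln (joe \<theta> u v))"
      by argo
    with der le show ?thesis
      by blast
  qed
  then show "\<exists>K. \<forall>u\<in>{0..1}. \<forall>v\<in>{0..1}. joe \<theta> u v > 0 \<longrightarrow> joe \<theta> u v \<le> 1 \<and>
      (\<exists>D. ((\<lambda>t. ln (joe t u v)) has_real_derivative D) (at \<theta> within {1..}) \<and>
        \<bar>D\<bar> \<le> K * (1 - ln (joe \<theta> u v)))"
    by blast
qed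

theorem mainTheorem2:
  "power_bounded {0<..} clayton \<and>
   power_bounded {1..} gumbel \<and>
   power_bounded (UNIV - {0}) frank \<and>
   power_bounded {1..} joe"
  using power_bounded_clayton power_bounded_gumbel power_bounded_frank power_bounded_joe by blast

end
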